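(* Let $\gamma$ be a probability measure on $\mathcal{Y}$, let the marginal performance measure $H^g:\mathcal{Y}\to\mathbf{R}$ be measurable, and suppose that $\Lambda_\gamma(c,H^g)$ is finite for $c$ in a neighborhood of $0$. Then for every probability measure $\lambda$ on $\mathcal{Y}$ with $\mathcal{R}(\lambda\mid\gamma)<\infty$, setting $Q=\lambda\otimes\nu$ and $P=\gamma\otimes\nu$, $$-\Xi(\lambda\mid\gamma;-H^g)\;\le\;\mathbf{E}_Q[g(\bar u)]-\mathbf{E}_P[g(\bar u)]\;\le\;\Xi(\lambda\mid\gamma;H^g).$$ Further, the divergence can be linearized with respect to the relative entropy: with $\gamma,\nu,h$ fixed, for each choice of sign, $$\Xi(\lambda\mid\gamma;\pm H^g)=\sqrt{\mathrm{Var}_\gamma[H^g]}\,\sqrt{2\,\mathcal{R}(\lambda\mid\gamma)}+O(\mathcal{R}(\lambda\mid\gamma))\qquad\text{as }\mathcal{R}(\lambda\mid\gamma)\to 0.$$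
   Context: Let $\mathcal{Y},\mathcal{Z}$ be Polish spaces, and let $\nu(dz\mid y)$ be a probability kernel from $\mathcal{Y}$ to $\mathcal{Z}$. (In the application, $y$ is a discretized random coefficient field and $z$ is the discrete solution $\bar u$ of a random PDE given $y$.) The quantity of interest is represented as $g(\bar u)=h(y,z)$ for a measurable $h:\mathcal{Y}\times\mathcal{Z}\to\mathbf{R}$. The marginal performance measure is $$H^g(y)=\int_{\mathcal{Z}}h(y,z)\,\nu(dz\mid y),\qquad y\in\mathcal{Y}.$$ For a probability measure $\lambda$ on $\mathcal{Y}$, $\lambda\otimes\nu$ denotes the measure $\nu(dz\mid y)\lambda(dy)$ on $\mathcal{Y}\times\mathcal{Z}$, and the expectation under $Q=\lambda\otimes\nu$ is the iterated integral $$\mathbf{E}_Q[g(\bar u)]=\int_{\mathcal{Y}}\int_{\mathcal{Z}}h(y,z)\,\nu(dz\mid y)\,\lambda(dy)=\mathbf{E}_\lambda[H^g];$$ likewise for $P=\gamma\otimes\nu$. Relative entropy: $\mathcal{R}(\lambda\mid\gamma)=\int\log\frac{d\lambda}{d\gamma}\,d\lambda$ if $\lambda\ll\gamma$, and $+\infty$ otherwise. Risk-sensitive performance measure: for $F=\pm H^g$, $$\Lambda_\gamma(c,F)=\frac1c\log\mathbf{E}_\gamma\big[e^{c(F-\mathbf{E}_\gamma[F])}\big],$$ with values in $(-\infty,+\infty]$; it is used for $c>0$ in the infimum below, and "finite in a neighborhood of $c=0$" means that there is $c_0>0$ with $\mathbf{E}_\gamma[e^{cH^g}]<\infty$ for all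 $|c|<c_0$. Hybrid information divergence: for $F=\pm H^g$, $$\Xi(\lambda\mid\gamma;F)=\inf_{c>0}\Big\{\Lambda_\gamma(c,F)+\frac1c\mathcal{R}(\lambda\mid\gamma)\Big\}.$$ *)

theory Defs
  imports "HOL-Probability.Probability" "HOL-Library.Landau_Symbols"
begin

text \<open>
  Throughout, a probability measure on a Polish space is an element of
  \<open>space (prob_algebra borel)\<close>, and a probability kernel is a measurable map into
  \<open>prob_algebra borel\<close>.
\<close>

text \<open>
  The function \<open>y \<mapsto> \<integral> h(y, z) \<nu>(dz | y)\<close>.  It is meaningful as a real-valued function when
  every section \<open>h(y, _)\<close> is \<open>\<nu>(_ | y)\<close>-integrable; this is a hypothesis wherever it is used.
\<close>
definition marginal_performance ::
  "('y \<Rightarrow> 'z measure) \<Rightarrow> ('y \<times> 'z \<Rightarrow> real) \<Rightarrow> 'y \<Rightarrow> real" where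
  "marginal_performance \<nu> h y = (\<integral>z. h (y, z) \<partial>\<nu> y)"

definition joint_measure ::
  "'y::topological_space measure \<Rightarrow> ('y \<Rightarrow> 'z::topological_space measure) \<Rightarrow> ('y \<times> 'z) measure" where
  "joint_measure \<mu> \<nu> = bind \<mu> (\<lambda>y. distr (\<nu> y) (borel \<Otimes>\<^sub>M borel) (Pair y))"

text \<open>
  The expectation of \<open>h\<close> under \<open>\<mu> \<otimes> \<nu>\<close> is by definition the iterated integral, so that it exists
  as soon as the marginal performance measure is \<open>\<mu>\<close>-integrable, even when \<open>h\<close> is not integrable
  with respect to the measure \<open>joint_measure \<mu> \<nu>\<close> on the product.  When it is, the two
  expectations agree, see \<open>joint_expectation_eq_integral\<close> below.
\<close>
definition joint_expectation ::
  "'y measure \<Rightarrow> ('y \<Rightarrow> 'z measure) \<Rightarrow> ('y \<times> 'z \<Rightarrow> real) \<Rightarrow> real" where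
  "joint_expectation \<mu> \<nu> h = (\<integral>y. (\<integral>z. h (y, z) \<partial>\<nu> y) \<partial>\<mu>)"

text \<open>
  The negative part of \<open>ln (d\<mu>/d\<gamma>)\<close> is always \<open>\<mu>\<close>-integrable (as \<open>x ln x \<ge> - 1/e\<close>), so when
  \<open>\<mu>\<close> is absolutely continuous but \<open>ln (d\<mu>/d\<gamma>)\<close> is not \<open>\<mu>\<close>-integrable, its integral is \<open>+\<infinity>\<close>.
  Note that \<^const>\<open>KL_divergence\<close> and \<^const>\<open>absolutely_continuous\<close> take the
  reference measure first.
\<close>
definition relative_entropy :: "'a measure \<Rightarrow> 'a measure \<Rightarrow> ereal" where
  "relative_entropy \<mu> \<gamma> =
    (if absolutely_continuous \<gamma> \<mu> \<and> integrable \<mu> (entropy_density (exp 1) \<gamma> \<mu>)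
     then ereal (KL_divergence (exp 1) \<gamma> \<mu>) else \<infinity>)"

text \<open>
  For \<open>c > 0\<close> and measurable \<open>F\<close>, failure of integrability of the nonnegative integrand means that
  its expectation is \<open>\<infinity>\<close>, whence the value \<open>\<infinity>\<close>.
\<close>
definition risk_sensitive :: "'a measure \<Rightarrow> real \<Rightarrow> ('a \<Rightarrow> real) \<Rightarrow> ereal" where
  "risk_sensitive \<gamma> c F =
    (if integrable \<gamma> (\<lambda>y. exp (c * (F y - (\<integral>x. F x \<partial>\<gamma>))))
     then ereal (1 / c * ln (\<integral>y. exp (c * (F y - (\<integral>x. F x \<partial>\<gamma>))) \<partial>\<gamma>)) else \<infinity>)"

definition hybrid_divergence :: "'a measure \<Rightarrow> 'a measure \<Rightarrow> ('a \<Rightarrow> real) \<Rightarrow> ereal" where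
  "hybrid_divergence \<mu> \<gamma> F =
    (INF c\<in>{0<..}. risk_sensitive \<gamma> c F + ereal (1 / c) * relative_entropy \<mu> \<gamma>)"

text \<open>
  Probability measures \<open>\<mu>\<close> with \<open>relative_entropy \<mu> \<gamma>\<close> tending to \<open>0\<close>: a property holds eventually
  iff, for some \<open>\<delta> > 0\<close>, it holds for all probability measures \<open>\<mu>\<close> with
  \<open>relative_entropy \<mu> \<gamma> < \<delta>\<close> (see \<open>eventually_entropy_to_0\<close>, where the absolute value is
  immaterial because relative entropy between probability measures is nonnegative).
\<close>
definition entropy_to_0 :: "'a::topological_space measure \<Rightarrow> 'a measure filter" where
  "entropy_to_0 \<gamma> =
    inf (filtercomap (\<lambda>\<mu>. relative_entropy \<mu> \<gamma>) (nhds 0)) (principal (space (prob_algebra borel)))"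

lemma space_prob_algebra_borel_iff:
  "\<mu> \<in> space (prob_algebra borel) \<longleftrightarrow> prob_space \<mu> \<and> sets \<mu> = sets borel"
  by (auto simp: space_prob_algebra)

lemma joint_kernel_measurable:
  fixes \<nu> :: "'y::polish_space \<Rightarrow> 'z::polish_space measure"
  assumes [measurable]: "\<nu> \<in> borel \<rightarrow>\<^sub>M prob_algebra borel"
  shows "(\<lambda>y. distr (\<nu> y) (borel \<Otimes>\<^sub>M borel) (Pair y)) \<in> borel \<rightarrow>\<^sub>M subprob_algebra (borel \<Otimes>\<^sub>M borel)"
proof (rule measurable_distr2)
  show "\<nu> \<in> borel \<rightarrow>\<^sub>M subprob_algebra borel"
    by (rule measurable_prob_algebraD[OF assms])
qed measurable

lemma nn_integral_joint_measure:
  fixes \<nu> :: "'y::polish_space \<Rightarrow> 'z::polish_space measure"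
  assumes \<mu>: "\<mu> \<in> space (prob_algebra borel)"
    and \<nu>: "\<nu> \<in> borel \<rightarrow>\<^sub>M prob_algebra borel"
    and f[measurable]: "f \<in> borel_measurable (borel \<Otimes>\<^sub>M borel)"
  shows "(\<integral>\<^sup>+x. f x \<partial>joint_measure \<mu> \<nu>) = (\<integral>\<^sup>+y. \<integral>\<^sup>+z. f (y, z) \<partial>\<nu> y \<partial>\<mu>)"
proof -
  have sl: "sets \<mu> = sets borel"
    using \<mu> by (simp add: space_prob_algebra)
  have k: "(\<lambda>y. distr (\<nu> y) (borel \<Otimes>\<^sub>M borel) (Pair y)) \<in> \<mu> \<rightarrow>\<^sub>M subprob_algebra (borel \<Otimes>\<^sub>M borel)"
    using joint_kernel_measurable[OF \<nu>] by (simp add: measurable_cong_sets[OF sl refl])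
  have s: "sets (\<nu> y) = sets borel" for y
    using measurable_space[OF \<nu>, of y] by (simp add: space_prob_algebra)
  show ?thesis
    unfolding joint_measure_def nn_integral_bind[OF f k]
    by (intro nn_integral_cong nn_integral_distr) (auto simp: measurable_cong_sets[OF s refl])
qed

lemma joint_expectation_eq_integral:
  fixes \<nu> :: "'y::polish_space \<Rightarrow> 'z::polish_space measure"
  assumes \<mu>: "\<mu> \<in> space (prob_algebra borel)"
    and \<nu>: "\<nu> \<in> borel \<rightarrow>\<^sub>M prob_algebra borel"
    and int: "integrable (joint_measure \<mu> \<nu>) h"
    and h[measurable]: "h \<in> borel_measurable (borel \<Otimes>\<^sub>M borel)"
  shows "joint_expectation \<mu> \<nu> h = (\<integral>x. h x \<partial>joint_measure \<mu> \<nu>)"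
proof -
  have sl: "sets \<mu> = sets borel"
    using \<mu> by (simp add: space_prob_algebra)
  have s: "sets (\<nu> y) = sets borel" for y
    using measurable_space[OF \<nu>, of y] by (simp add: space_prob_algebra)
  have sub: "\<nu> \<in> \<mu> \<rightarrow>\<^sub>M subprob_algebra borel"
    using measurable_prob_algebraD[OF \<nu>] by (simp add: measurable_cong_sets[OF sl refl])
  note cong = measurable_cong_sets[OF s refl] measurable_cong_sets[OF sl refl]
  define p n where "p y = (\<integral>\<^sup>+z. ennreal (h (y, z)) \<partial>\<nu> y)"
    and "n y = (\<integral>\<^sup>+z. ennreal (- h (y, z)) \<partial>\<nu> y)" for y
  have fin: "(\<integral>\<^sup>+y. p y \<partial>\<mu>) < \<infinity>" "(\<integral>\<^sup>+y. n y \<partial>\<mu>) < \<infinity>"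
    using int unfolding real_integrable_def p_def n_def
    by (auto simp: nn_integral_joint_measure[OF \<mu> \<nu>] less_top)
  have hm: "(\<lambda>z. h (y, z)) \<in> borel_measurable (\<nu> y)" for y
    by (simp add: cong)
  have meas: "p \<in> borel_measurable \<mu>" "n \<in> borel_measurable \<mu>"
  proof -
    have [measurable]: "\<nu> \<in> borel \<rightarrow>\<^sub>M subprob_algebra borel"
      by (rule measurable_prob_algebraD[OF \<nu>])
    show "p \<in> borel_measurable \<mu>" "n \<in> borel_measurable \<mu>"
      unfolding p_def n_def cong
      by (rule nn_integral_measurable_subprob_algebra2[of _ _ borel]; measurable)+
  qed
  have ae: "AE y in \<mu>. p y \<noteq> \<infinity>" "AE y in \<mu>. n y \<noteq> \<infinity>"
    using nn_integral_noteq_infinite[OF meas(1)] nn_integral_noteq_infinite[OF meas(2)] fin by auto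
  have pn: "(\<integral>z. h (y, z) \<partial>\<nu> y) = enn2real (p y) - enn2real (n y)"
    if "p y \<noteq> \<infinity>" "n y \<noteq> \<infinity>" for y
    using that hm[of y] unfolding p_def n_def
    by (intro real_lebesgue_integral_def) (auto simp: real_integrable_def)
  have ne: "(\<integral>\<^sup>+y. ennreal (enn2real (p y)) \<partial>\<mu>) = (\<integral>\<^sup>+y. p y \<partial>\<mu>)"
    "(\<integral>\<^sup>+y. ennreal (enn2real (n y)) \<partial>\<mu>) = (\<integral>\<^sup>+y. n y \<partial>\<mu>)"
    using ae by (auto intro!: nn_integral_cong_AE simp: ennreal_enn2real_if)
  have ip: "integrable \<mu> (\<lambda>y. enn2real (p y))" "integrable \<mu> (\<lambda>y. enn2real (n y))"
    using meas fin ne by (auto intro!: integrableI_nonneg)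
  have ep: "(\<integral>y. enn2real (p y) \<partial>\<mu>) = enn2real (\<integral>\<^sup>+y. p y \<partial>\<mu>)"
    "(\<integral>y. enn2real (n y) \<partial>\<mu>) = enn2real (\<integral>\<^sup>+y. n y \<partial>\<mu>)"
    using meas by (simp_all add: integral_eq_nn_integral ne)
  have "joint_expectation \<mu> \<nu> h = (\<integral>y. enn2real (p y) - enn2real (n y) \<partial>\<mu>)"
  proof -
    have "(\<integral>z. h (y, z) \<partial>\<nu> y) =
        (if p y \<noteq> \<infinity> \<and> n y \<noteq> \<infinity> then enn2real (p y) - enn2real (n y) else 0)" for y
      using pn hm[of y] by (auto simp: real_integrable_def p_def n_def intro!: not_integrable_integral_eq)
    moreover note [measurable] = meas
    ultimately have "(\<lambda>y. \<integral>z. h (y, z) \<partial>\<nu> y) \<in> borel_measurable \<mu>"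
      by simp
    then show ?thesis
      unfolding joint_expectation_def using ae pn meas by (intro integral_cong_AE) auto
  qed
  also have "\<dots> = enn2real (\<integral>\<^sup>+y. p y \<partial>\<mu>) - enn2real (\<integral>\<^sup>+y. n y \<partial>\<mu>)"
    using ip ep by simp
  also have "\<dots> = (\<integral>x. h x \<partial>joint_measure \<mu> \<nu>)"
    using int by (simp add: real_lebesgue_integral_def nn_integral_joint_measure[OF \<mu> \<nu>] p_def n_def)
  finally show ?thesis .
qed

lemma eventually_entropy_to_0:
  "eventually P (entropy_to_0 \<gamma>) \<longleftrightarrow>
    (\<exists>\<delta>>0. \<forall>\<mu>\<in>space (prob_algebra borel). \<bar>relative_entropy \<mu> \<gamma>\<bar> < ereal \<delta> \<longrightarrow> P \<mu>)"
proof -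
  have nhds: "eventually Q (nhds (0::ereal)) \<longleftrightarrow> (\<exists>\<delta>>0. \<forall>r. \<bar>r\<bar> < ereal \<delta> \<longrightarrow> Q r)" for Q
  proof
    assume "eventually Q (nhds (0::ereal))"
    then obtain S where S: "open S" "0 \<in> S" "\<And>r. r \<in> S \<Longrightarrow> Q r"
      by (auto simp: eventually_nhds)
    obtain e where e: "e > 0" "{0 - e <..< 0 + e} \<subseteq> S"
      using ereal_open_cont_interval[OF S(1,2)] by auto
    obtain \<delta> where \<delta>: "0 < \<delta>" "ereal \<delta> < e"
      using e(1) ereal_dense2[of 0 e] by auto
    have "Q r" if "\<bar>r\<bar> < ereal \<delta>" for r
    proof (rule S(3), rule subsetD[OF e(2)])
      show "r \<in> {0 - e <..< 0 + e}"
        using that \<delta> by (cases r; cases e) auto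
    qed
    with \<delta> show "\<exists>\<delta>>0. \<forall>r. \<bar>r\<bar> < ereal \<delta> \<longrightarrow> Q r"
      by blast
  next
    assume "\<exists>\<delta>>0. \<forall>r. \<bar>r\<bar> < ereal \<delta> \<longrightarrow> Q r"
    then obtain \<delta> where \<delta>: "0 < \<delta>" "\<And>r. \<bar>r\<bar> < ereal \<delta> \<Longrightarrow> Q r"
      by auto
    have "r \<in> {- ereal \<delta> <..< ereal \<delta>} \<Longrightarrow> \<bar>r\<bar> < ereal \<delta>" for r
      by (cases r) auto
    with \<delta> show "eventually Q (nhds (0::ereal))"
      unfolding eventually_nhds by (intro exI[of _ "{- ereal \<delta> <..< ereal \<delta>}"]) auto
  qed
  show ?thesis
    unfolding entropy_to_0_def eventually_inf_principal eventually_filtercomap nhds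
    by (auto; blast)
qed

end

theory Submission
  imports Defs
begin

text \<open>
  Both halves of the theorem rest on the Gibbs (Donsker--Varadhan) inequality
  \<open>E\<^sub>\<mu>[X] \<le> ln E\<^sub>\<gamma>[exp X] + R\<close>, where \<open>R\<close> is the entropy of \<open>\<mu>\<close> relative to \<open>\<gamma>\<close>.
  With \<open>f = d\<mu>/d\<gamma>\<close>, it is the integral of the pointwise Young inequality
  \<open>f u \<le> f ln f - f + exp u\<close> (\<open>entropy_young\<close>), taken at \<open>u = X - ln E\<^sub>\<gamma>[exp X]\<close>
  so that the integrals of the last two terms cancel.  The same inequality at \<open>u = a \<bar>X\<bar>\<close> shows that exponential
  moments under \<open>\<gamma>\<close> make \<open>X\<close> integrable under every \<open>\<mu>\<close> of finite relative entropy.  For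
  \<open>X = c (F - E\<^sub>\<gamma>[F])\<close>, dividing by \<open>c > 0\<close> and taking the infimum over \<open>c\<close> bounds
  \<open>E\<^sub>\<mu>[F] - E\<^sub>\<gamma>[F]\<close> by the hybrid divergence of \<open>F\<close>; the two signs of \<open>F\<close> give the two bounds.

  For the linearization, let \<open>s\<^sup>2\<close> be the variance of \<open>F\<close> under \<open>\<gamma>\<close> and \<open>S(c)\<close> its risk-sensitive
  performance measure.  Taylor expansion gives \<open>S(c) = s\<^sup>2 c / 2 + O(c\<^sup>2)\<close> as \<open>c\<close> decreases to \<open>0\<close>
  (\<open>cumulant_quadratic\<close>), and \<open>s\<^sup>2 c / 2 + R / c\<close> attains its minimum \<open>s \<surd>(2 R)\<close> at
  \<open>c = \<surd>(2 R) / s\<close>.  Near this minimizer the error \<open>O(c\<^sup>2)\<close> is \<open>O(R)\<close>, and the values of \<open>c\<close> beyond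
  the range of the expansion cannot compete, because \<open>S\<close> is nondecreasing (\<open>cumulant_rate_mono\<close>).
  The lemma \<open>INF_perturbed_linear\<close> carries out this comparison for an arbitrary such \<open>S\<close>.  If
  \<open>s = 0\<close> then \<open>F\<close> is almost surely constant and the divergence vanishes.
\<close>

section \<open>The Gibbs variational inequality\<close>

text \<open>
  Legendre duality between \<open>f ln f - f\<close> and \<open>exp\<close>: after division by \<open>f\<close> this is
  \<open>1 + t \<le> exp t\<close> at \<open>t = u - ln f\<close>.
\<close>

lemma entropy_young:
  fixes f u :: real
  assumes "f \<ge> 0"
  shows "f * u \<le> f * ln f - f + exp u"
proof (cases "f = 0")
  case False
  with assms have f: "f > 0" by simp
  have "1 + (u - ln f) \<le> exp (u - ln f)"
    by (rule exp_ge_add_one_self)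
  then have "f * (1 + (u - ln f)) \<le> f * exp (u - ln f)"
    using f by (intro mult_left_mono) auto
  also have "\<dots> = exp u"
    using f by (simp add: exp_diff)
  finally show ?thesis
    by (simp add: algebra_simps)
qed simp

text \<open>
  Working with a real-valued density under \<open>\<gamma>\<close> turns statements about \<open>\<mu>\<close> and its
  relative entropy into integrals of pointwise inequalities with respect to \<open>\<gamma>\<close>.
\<close>

lemma relative_entropy_finiteE:
  assumes "prob_space \<gamma>" "prob_space \<mu>" "sets \<mu> = sets \<gamma>" "relative_entropy \<mu> \<gamma> < \<infinity>"
  obtains f :: "'a \<Rightarrow> real"
    where "f \<in> borel_measurable \<gamma>" "\<And>x. f x \<ge> 0" "\<mu> = density \<gamma> (\<lambda>x. ennreal (f x))"
      "integrable \<gamma> f" "(\<integral>x. f x \<partial>\<gamma>) = 1"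
      "integrable \<gamma> (\<lambda>x. f x * ln (f x))"
      "relative_entropy \<mu> \<gamma> = ereal (\<integral>x. f x * ln (f x) \<partial>\<gamma>)"
proof -
  interpret G: prob_space \<gamma> by fact
  interpret M: prob_space \<mu> by fact
  have ac: "absolutely_continuous \<gamma> \<mu>"
    and int: "integrable \<mu> (entropy_density (exp 1) \<gamma> \<mu>)"
    and R: "relative_entropy \<mu> \<gamma> = ereal (KL_divergence (exp 1) \<gamma> \<mu>)"
    using assms(4) by (auto simp: relative_entropy_def split: if_splits)
  obtain f where f: "f \<in> borel_measurable \<gamma>" "AE x in \<gamma>. RN_deriv \<gamma> \<mu> x = ennreal (f x)"
      "AE x in \<mu>. 0 < f x" "\<And>x. 0 \<le> f x"
    using G.real_RN_deriv[OF M.finite_measure_axioms ac assms(3)] by metis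
  have \<mu>: "\<mu> = density \<gamma> (\<lambda>x. ennreal (f x))"
  proof -
    have "\<mu> = density \<gamma> (RN_deriv \<gamma> \<mu>)"
      using G.density_RN_deriv[OF ac assms(3)] by simp
    also have "\<dots> = density \<gamma> (\<lambda>x. ennreal (f x))"
      using f by (intro density_cong) auto
    finally show ?thesis .
  qed
  have fi: "integrable \<gamma> f" "(\<integral>x. f x \<partial>\<gamma>) = 1"
  proof -
    have "(\<integral>\<^sup>+x. ennreal (f x) \<partial>\<gamma>) = emeasure \<mu> (space \<mu>)"
      unfolding \<mu> using f(1) by (subst emeasure_density) (auto cong: nn_integral_cong)
    then have 1: "(\<integral>\<^sup>+x. ennreal (f x) \<partial>\<gamma>) = 1"
      by (simp add: M.emeasure_space_1)
    show "integrable \<gamma> f"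
      using f 1 by (intro integrableI_nonneg) auto
    show "(\<integral>x. f x \<partial>\<gamma>) = 1"
      using f 1 by (simp add: integral_eq_nn_integral)
  qed
  define L where "L = entropy_density (exp 1) \<gamma> \<mu>"
  have ae: "AE x in \<gamma>. f x * L x = f x * ln (f x)"
    using f(2) by eventually_elim (simp add: L_def entropy_density_def f(4) log_def)
  have [measurable]: "L \<in> borel_measurable \<gamma>"
    unfolding L_def by measurable
  note [measurable] = f(1)
  have "integrable \<gamma> (\<lambda>x. f x * L x)"
    using int unfolding L_def[symmetric] unfolding \<mu> by (simp add: integrable_real_density f)
  then have i: "integrable \<gamma> (\<lambda>x. f x * ln (f x))"
    using ae by (subst integrable_cong_AE[symmetric]) auto
  have "KL_divergence (exp 1) \<gamma> \<mu> = (\<integral>x. f x * L x \<partial>\<gamma>)"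
    unfolding KL_divergence_def L_def[symmetric] unfolding \<mu> by (simp add: integral_real_density f)
  also have "\<dots> = (\<integral>x. f x * ln (f x) \<partial>\<gamma>)"
    using ae by (intro integral_cong_AE) auto
  finally show ?thesis
    using that[OF f(1) f(4) \<mu> fi i] R by simp
qed

text \<open>
  Integrate \<open>entropy_young\<close> at \<open>u = 0\<close>: the density and the constant \<open>1\<close> have the same integral.
\<close>

lemma relative_entropy_nonneg:
  assumes "prob_space \<gamma>" "prob_space \<mu>" "sets \<mu> = sets \<gamma>"
  shows "relative_entropy \<mu> \<gamma> \<ge> 0"
proof (cases "relative_entropy \<mu> \<gamma> < \<infinity>")
  case True
  interpret prob_space \<gamma> by fact
  from relative_entropy_finiteE[OF assms True] obtain f where f: "\<And>x. f x \<ge> (0::real)"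
      "integrable \<gamma> f" "(\<integral>x. f x \<partial>\<gamma>) = 1" "integrable \<gamma> (\<lambda>x. f x * ln (f x))"
      "relative_entropy \<mu> \<gamma> = ereal (\<integral>x. f x * ln (f x) \<partial>\<gamma>)" by metis
  have "(\<integral>x. 0 \<partial>\<gamma>) \<le> (\<integral>x. f x * ln (f x) - f x + 1 \<partial>\<gamma>)"
    using f entropy_young[OF f(1), where u = 0] by (intro integral_mono) auto
  also have "\<dots> = (\<integral>x. f x * ln (f x) \<partial>\<gamma>)"
    using f by (simp add: prob_space)
  finally show ?thesis
    using f by simp
qed simp

text \<open>
  The Young inequality at \<open>u = a \<bar>X\<bar>\<close> dominates \<open>a f \<bar>X\<bar>\<close> by a \<open>\<gamma>\<close>-integrable function.
\<close>

lemma integrable_of_finite_relative_entropy: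
  fixes X :: "'a \<Rightarrow> real"
  assumes "prob_space \<gamma>" "prob_space \<mu>" "sets \<mu> = sets \<gamma>" "relative_entropy \<mu> \<gamma> < \<infinity>"
    and X: "X \<in> borel_measurable \<gamma>" and a: "a > 0" "integrable \<gamma> (\<lambda>x. exp (a * \<bar>X x\<bar>))"
  shows "integrable \<mu> X"
proof -
  from relative_entropy_finiteE[OF assms(1-4)] obtain f where f: "f \<in> borel_measurable \<gamma>"
      "\<And>x. f x \<ge> (0::real)" "\<mu> = density \<gamma> (\<lambda>x. ennreal (f x))"
      "integrable \<gamma> f" "integrable \<gamma> (\<lambda>x. f x * ln (f x))" by metis
  note [measurable] = f(1) X
  have "integrable \<gamma> (\<lambda>x. f x * X x)"
  proof (rule Bochner_Integration.integrable_bound)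
    show "integrable \<gamma> (\<lambda>x. (f x * ln (f x) - f x + exp (a * \<bar>X x\<bar>)) / a)"
      using f a by auto
    have "norm (f x * X x) \<le> norm ((f x * ln (f x) - f x + exp (a * \<bar>X x\<bar>)) / a)" for x
    proof -
      have "f x * \<bar>X x\<bar> * a \<le> f x * ln (f x) - f x + exp (a * \<bar>X x\<bar>)"
        using entropy_young[OF f(2), of x "a * \<bar>X x\<bar>"] by (simp add: mult_ac)
      then have "f x * \<bar>X x\<bar> \<le> (f x * ln (f x) - f x + exp (a * \<bar>X x\<bar>)) / a"
        using a by (simp add: pos_le_divide_eq)
      then show ?thesis
        using f(2)[of x] by (metis abs_ge_self abs_mult abs_of_nonneg order_trans real_norm_def)
    qed
    then show "AE x in \<gamma>. norm (f x * X x) \<le> norm ((f x * ln (f x) - f x + exp (a * \<bar>X x\<bar>)) / a)"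
      by simp
  qed measurable
  then show ?thesis
    using f by (simp add: integrable_real_density)
qed

text \<open>
  Subtracting \<open>ln Z\<close>, with \<open>Z\<close> the integral of \<open>exp X\<close>, normalizes the exponential: then \<open>f\<close> and
  \<open>exp (X - ln Z)\<close> both integrate to \<open>1\<close>, and of the right-hand side of the Young inequality only
  the entropy remains.
\<close>

lemma gibbs_inequality:
  fixes X :: "'a \<Rightarrow> real"
  assumes "prob_space \<gamma>" "prob_space \<mu>" "sets \<mu> = sets \<gamma>" "relative_entropy \<mu> \<gamma> < \<infinity>"
    and X: "integrable \<mu> X" and e: "integrable \<gamma> (\<lambda>x. exp (X x))"
  shows "ereal (\<integral>x. X x \<partial>\<mu>) \<le> ereal (ln (\<integral>x. exp (X x) \<partial>\<gamma>)) + relative_entropy \<mu> \<gamma>"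
proof -
  interpret prob_space \<gamma> by fact
  from relative_entropy_finiteE[OF assms(1-4)] obtain f where f: "f \<in> borel_measurable \<gamma>"
      "\<And>x. f x \<ge> (0::real)" "\<mu> = density \<gamma> (\<lambda>x. ennreal (f x))"
      "integrable \<gamma> f" "(\<integral>x. f x \<partial>\<gamma>) = 1" "integrable \<gamma> (\<lambda>x. f x * ln (f x))"
      "relative_entropy \<mu> \<gamma> = ereal (\<integral>x. f x * ln (f x) \<partial>\<gamma>)" by metis
  have Xm: "X \<in> borel_measurable \<gamma>"
    using borel_measurable_integrable[OF X] measurable_cong_sets[OF assms(3) refl] by blast
  note [measurable] = f(1) Xm
  have fX: "integrable \<gamma> (\<lambda>x. f x * X x)" "(\<integral>x. X x \<partial>\<mu>) = (\<integral>x. f x * X x \<partial>\<gamma>)"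
    using X f by (simp_all add: integrable_real_density integral_real_density)
  define Z where "Z = (\<integral>x. exp (X x) \<partial>\<gamma>)"
  have Z: "Z > 0"
    unfolding Z_def using e by (intro expectation_greater) auto
  have eX: "exp (X x - ln Z) = exp (X x) / Z" for x
    using Z by (simp add: exp_diff)
  have "(\<integral>x. f x * (X x - ln Z) \<partial>\<gamma>) \<le> (\<integral>x. f x * ln (f x) - f x + exp (X x) / Z \<partial>\<gamma>)"
    using f fX e entropy_young[OF f(2), where u = "X _ - ln Z"]
    by (intro integral_mono) (auto simp: right_diff_distrib eX)
  also have "\<dots> = (\<integral>x. f x * ln (f x) \<partial>\<gamma>)"
    using f e Z by (simp add: Z_def[symmetric])
  also have "(\<integral>x. f x * (X x - ln Z) \<partial>\<gamma>) = (\<integral>x. X x \<partial>\<mu>) - ln Z"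
    using f fX by (simp add: right_diff_distrib)
  finally show ?thesis
    using f by (simp add: Z_def)
qed

text \<open>
  Each \<open>c > 0\<close> gives one bound, by the Gibbs inequality for \<open>c (F - E\<^sub>\<gamma>[F])\<close>; the hybrid
  divergence is the best of them.
\<close>

lemma expectation_diff_le_hybrid_divergence:
  fixes F :: "'a \<Rightarrow> real"
  assumes "prob_space \<gamma>" "prob_space \<mu>" "sets \<mu> = sets \<gamma>" "relative_entropy \<mu> \<gamma> < \<infinity>"
    and F: "integrable \<mu> F"
  shows "ereal ((\<integral>x. F x \<partial>\<mu>) - (\<integral>x. F x \<partial>\<gamma>)) \<le> hybrid_divergence \<mu> \<gamma> F"
  unfolding hybrid_divergence_def
proof (rule INF_greatest)
  interpret \<mu>: prob_space \<mu> by fact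
  fix c :: real assume "c \<in> {0<..}"
  then have c: "c > 0" by simp
  obtain R where R: "relative_entropy \<mu> \<gamma> = ereal R"
    using assms(4) relative_entropy_nonneg[OF assms(1-3)] by (cases "relative_entropy \<mu> \<gamma>") auto
  define X where "X x = c * (F x - (\<integral>x. F x \<partial>\<gamma>))" for x
  show "ereal ((\<integral>x. F x \<partial>\<mu>) - (\<integral>x. F x \<partial>\<gamma>))
      \<le> risk_sensitive \<gamma> c F + ereal (1 / c) * relative_entropy \<mu> \<gamma>"
  proof (cases "integrable \<gamma> (\<lambda>x. exp (X x))")
    case True
    have "ereal (\<integral>x. X x \<partial>\<mu>) \<le> ereal (ln (\<integral>x. exp (X x) \<partial>\<gamma>)) + relative_entropy \<mu> \<gamma>"
      using F True assms(1-4) by (intro gibbs_inequality) (auto simp: X_def)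
    then have "c * ((\<integral>x. F x \<partial>\<mu>) - (\<integral>x. F x \<partial>\<gamma>)) \<le> ln (\<integral>x. exp (X x) \<partial>\<gamma>) + R"
      using F R by (simp add: X_def \<mu>.prob_space)
    then have "(\<integral>x. F x \<partial>\<mu>) - (\<integral>x. F x \<partial>\<gamma>) \<le> 1 / c * ln (\<integral>x. exp (X x) \<partial>\<gamma>) + R / c"
      using c by (simp add: field_simps)
    then show ?thesis
      using True R by (simp add: risk_sensitive_def X_def)
  next
    case False
    then show ?thesis
      using R by (simp add: risk_sensitive_def X_def)
  qed
qed

section \<open>Minimizing a perturbed linear function plus \<open>R / c\<close>\<close>

text \<open>
  The comparison of the infimum of \<open>S c + R / c\<close> with that of \<open>s\<^sup>2 c / 2 + R / c\<close>, which is
  \<open>s \<surd>(2 R)\<close>.  For the lower bound, \<open>c\<close> ranges over three zones.  If \<open>c\<close> is at most a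
  constant times \<open>\<surd>R\<close>, the arithmetic--geometric mean inequality applies and the error \<open>B c\<^sup>2\<close> is
  \<open>O(R)\<close>.  For larger \<open>c\<close> up to a fixed \<open>b\<close>, half of the linear term absorbs the error and the other
  half already exceeds \<open>s \<surd>(2 R)\<close>.  Beyond \<open>b\<close>, monotonicity bounds \<open>S\<close> below by the
  fixed positive number \<open>S b\<close>, which is larger than \<open>s \<surd>(2 R)\<close> once \<open>R\<close> is small.
\<close>

lemma INF_perturbed_linear:
  fixes S :: "real \<Rightarrow> ereal" and s B a :: real
  assumes s: "s > 0" and B: "B \<ge> 0" and a: "a > 0"
    and S: "\<And>c. 0 < c \<Longrightarrow> c \<le> a \<Longrightarrow> \<exists>k. S c = ereal k \<and> \<bar>k - s\<^sup>2 * c / 2\<bar> \<le> B * c\<^sup>2"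
    and mono: "\<And>c d. 0 < c \<Longrightarrow> c \<le> d \<Longrightarrow> S c \<le> S d"
  shows "\<exists>\<delta>>0. \<exists>C. \<forall>R. 0 \<le> R \<and> R < \<delta> \<longrightarrow>
    (\<exists>k. (INF c\<in>{0<..}. S c + ereal (R / c)) = ereal k \<and> \<bar>k - s * sqrt (2 * R)\<bar> \<le> C * R)"
proof -
  \<comment> \<open>On \<open>(0, b]\<close> the error \<open>B c\<^sup>2\<close> is at most \<open>s\<^sup>2 c / 4\<close>, half of the linear term;
    \<open>B + 1\<close> avoids division by zero.\<close>
  define b where "b = min a (s\<^sup>2 / (4 * (B + 1)))"
  have b: "b > 0" "b \<le> a" "B * b \<le> s\<^sup>2 / 4"
  proof -
    show "b > 0" "b \<le> a" using a s B by (auto simp: b_def field_simps intro!: divide_pos_pos)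
    have "B * b \<le> (B + 1) * (s\<^sup>2 / (4 * (B + 1)))"
      using B by (intro mult_mono) (use a in \<open>auto simp: b_def\<close>)
    also have "\<dots> = s\<^sup>2 / 4" using B by (simp add: field_simps)
    finally show "B * b \<le> s\<^sup>2 / 4" .
  qed
  have small: "\<exists>k. S c = ereal k \<and> \<bar>k - s\<^sup>2 * c / 2\<bar> \<le> B * c\<^sup>2 \<and> s\<^sup>2 * c / 4 \<le> k"
    if c: "0 < c" "c \<le> b" for c
  proof -
    obtain k where k: "S c = ereal k" "\<bar>k - s\<^sup>2 * c / 2\<bar> \<le> B * c\<^sup>2"
      using S[of c] c b by auto
    have "B * c * c \<le> B * b * c" using B c by (intro mult_right_mono mult_left_mono) auto
    also have "\<dots> \<le> s\<^sup>2 / 4 * c" using b c by (intro mult_right_mono) auto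
    finally show ?thesis using k by (intro exI[of _ k]) (auto simp: power2_eq_square)
  qed
  show ?thesis
  proof (rule exI[of _ "s\<^sup>2 * b\<^sup>2 / 32"], rule conjI, use s b in simp,
      rule exI[of _ "32 * B / s\<^sup>2"], intro allI impI)
    fix R :: real assume R: "0 \<le> R \<and> R < s\<^sup>2 * b\<^sup>2 / 32"
    \<comment> \<open>The bound on \<open>R\<close> is chosen such that \<open>s r\<close> is at most the lower bound \<open>s\<^sup>2 b / 4\<close> for \<open>S b\<close>.\<close>
    define r where "r = sqrt (2 * R)"
    have r: "r \<ge> 0" "r\<^sup>2 = 2 * R" using R by (auto simp: r_def)
    have "r\<^sup>2 \<le> (s * b / 4)\<^sup>2" using R r by (simp add: power_mult_distrib power_divide)
    then have rb: "r \<le> s * b / 4" using s b by (rule_tac power2_le_imp_le) auto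
    define I where "I = (INF c\<in>{0<..}. S c + ereal (R / c))"
    have lower: "ereal (s * r - 32 * B / s\<^sup>2 * R) \<le> I"
      unfolding I_def
    proof (rule INF_greatest)
      fix c :: real assume "c \<in> {0<..}"
      then have c: "c > 0" by simp
      have nn: "0 \<le> 32 * B / s\<^sup>2 * R" "0 \<le> R / c" using B R c by auto
      \<comment> \<open>The threshold \<open>4 r\<close> makes \<open>s\<^sup>2 c / 4 \<ge> s r\<close> above it, and \<open>B c\<^sup>2 \<le> 16 B r\<^sup>2 / s\<^sup>2 = 32 B R / s\<^sup>2\<close>
        below it.\<close>
      consider "c \<le> b" "s * c \<le> 4 * r" | "c \<le> b" "4 * r < s * c" | "c > b" by linarith
      then show "ereal (s * r - 32 * B / s\<^sup>2 * R) \<le> S c + ereal (R / c)"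
      proof cases
        case 1
        obtain k where k: "S c = ereal k" "\<bar>k - s\<^sup>2 * c / 2\<bar> \<le> B * c\<^sup>2"
          using small[OF c 1(1)] by auto
        have "0 \<le> (s * c - r)\<^sup>2 / (2 * c)" using c by simp
        also have "\<dots> = s\<^sup>2 * c / 2 + R / c - s * r"
          using c r by (simp add: power2_diff power_mult_distrib field_simps) (simp add: power2_eq_square)
        finally have 2: "s * r \<le> s\<^sup>2 * c / 2 + R / c" by simp
        have "(s * c)\<^sup>2 \<le> (4 * r)\<^sup>2" using 1 s c by (intro power_mono) auto
        then have "c\<^sup>2 \<le> 32 * R / s\<^sup>2"
          using r s by (simp add: power_mult_distrib field_simps)
        then have "B * c\<^sup>2 \<le> B * (32 * R / s\<^sup>2)" using B by (rule mult_left_mono)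
        then show ?thesis using k 2 by (simp add: mult_ac)
      next
        case 2
        obtain k where k: "S c = ereal k" "s\<^sup>2 * c / 4 \<le> k"
          using small[OF c 2(1)] by auto
        have "s * r \<le> s * (s * c / 4)" using 2 s by (intro mult_left_mono) auto
        then show ?thesis using k nn by (simp add: power2_eq_square)
      next
        case 3
        obtain k where k: "S b = ereal k" "s\<^sup>2 * b / 4 \<le> k"
          using small[OF b(1)] by auto
        have "s * r \<le> s * (s * b / 4)" using rb s by (intro mult_left_mono) auto
        then have "s * r - 32 * B / s\<^sup>2 * R \<le> k" using k nn by (simp add: power2_eq_square)
        then have "ereal (s * r - 32 * B / s\<^sup>2 * R) \<le> S b" using k by simp
        also have "\<dots> \<le> S c" using mono b 3 by simp
        also have "\<dots> \<le> S c + ereal (R / c)" using nn by (simp add: ereal_le_add_self)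
        finally show ?thesis .
      qed
    qed
    have upper: "I \<le> ereal (s * r + 32 * B / s\<^sup>2 * R)"
    proof (cases "R = 0")
      case False
      \<comment> \<open>The minimizer of \<open>s\<^sup>2 c / 2 + R / c\<close>.\<close>
      define c where "c = r / s"
      have r0: "r > 0" using False r by (cases "r = 0") auto
      have c: "c > 0" "c \<le> b"
        using r0 s rb b by (auto simp: c_def field_simps)
      obtain k where k: "S c = ereal k" "\<bar>k - s\<^sup>2 * c / 2\<bar> \<le> B * c\<^sup>2"
        using small[OF c] by auto
      have "I \<le> S c + ereal (R / c)" unfolding I_def using c by (intro INF_lower) auto
      also have "\<dots> = ereal (k + R / c)" using k by simp
      also have "k + R / c \<le> s * r + 32 * B / s\<^sup>2 * R"
      proof -
        have R': "R = r\<^sup>2 / 2" using r by simp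
        have 1: "s\<^sup>2 * c / 2 + R / c = s * r"
          unfolding R' using r0 s by (simp add: c_def power2_eq_square field_simps)
        have "B * c\<^sup>2 = 2 * (B / s\<^sup>2 * R)" unfolding R' by (simp add: c_def power_divide)
        also have "\<dots> \<le> 32 * (B / s\<^sup>2 * R)" using B R by (intro mult_right_mono) auto
        finally show ?thesis using 1 k by simp
      qed
      finally show ?thesis by simp
    next
      case True
      \<comment> \<open>For \<open>R = 0\<close> the infimum is not attained: \<open>c\<close> has to tend to \<open>0\<close>.\<close>
      have "I \<le> 0 + ereal e" if e: "e > 0" for e
      proof -
        define c where "c = min b (e / s\<^sup>2)"
        have c: "c > 0" "c \<le> b" "c \<le> e / s\<^sup>2" using b s e by (auto simp: c_def)
        obtain k where k: "S c = ereal k" "\<bar>k - s\<^sup>2 * c / 2\<bar> \<le> B * c\<^sup>2"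
          using small[OF c(1,2)] by auto
        have "B * c * c \<le> B * b * c" using B c by (intro mult_right_mono mult_left_mono) auto
        also have "\<dots> \<le> s\<^sup>2 / 4 * c" using b c by (intro mult_right_mono) auto
        finally have "B * c\<^sup>2 \<le> s\<^sup>2 * c / 4" by (simp add: power2_eq_square)
        moreover have "0 \<le> s\<^sup>2 * c" using c by simp
        ultimately have "k \<le> s\<^sup>2 * c" using k(2) by linarith
        also have "\<dots> \<le> e" using c s by (simp add: field_simps)
        finally have "k \<le> e" .
        have "I \<le> S c + ereal (R / c)" unfolding I_def using c by (intro INF_lower) auto
        then show ?thesis using k \<open>k \<le> e\<close> True by (simp add: order_trans)
      qed
      then have "I \<le> 0" by (rule ereal_le_epsilon2)
      then show ?thesis using True r by (simp add: zero_ereal_def)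
    qed
    obtain k where k: "I = ereal k" using lower upper by (cases I) auto
    show "\<exists>k. (INF c\<in>{0<..}. S c + ereal (R / c)) = ereal k \<and>
        \<bar>k - s * sqrt (2 * R)\<bar> \<le> 32 * B / s\<^sup>2 * R"
      using lower upper k unfolding I_def[symmetric] r_def[symmetric] by (intro exI[of _ k]) auto
  qed
qed

section \<open>The cumulant generating function near zero\<close>

lemma abs_power_le_exp:
  fixes a x :: real
  assumes "a > 0" "n > 0"
  shows "\<bar>x\<bar> ^ n \<le> (n / a) ^ n * exp (a * \<bar>x\<bar>)"
proof -
  define y where "y = a * \<bar>x\<bar> / n"
  have "y \<le> exp y"
    using exp_ge_add_one_self[of y] by linarith
  have "\<bar>x\<bar> ^ n = (n / a) ^ n * y ^ n"
    using assms by (simp add: y_def power_mult_distrib[symmetric])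
  also have "\<dots> \<le> (n / a) ^ n * exp y ^ n"
    using assms \<open>y \<le> exp y\<close> by (intro mult_left_mono power_mono) (auto simp: y_def)
  also have "exp y ^ n = exp (a * \<bar>x\<bar>)"
    using assms by (simp add: y_def exp_of_nat_mult[symmetric])
  finally show ?thesis .
qed

lemma ln_one_plus_lower:
  fixes x :: real
  assumes "x \<ge> 0"
  shows "x - x\<^sup>2 \<le> ln (1 + x)"
proof (cases "x \<le> 1")
  case False
  then have "x * 1 \<le> x * x" by (intro mult_left_mono) auto
  moreover have "0 \<le> ln (1 + x)" using assms by simp
  ultimately show ?thesis unfolding power2_eq_square by linarith
qed (use ln_one_plus_pos_lower_bound assms in auto)

lemma integrable_power_of_exp_moment:
  fixes X :: "'a \<Rightarrow> real"
  assumes [measurable]: "X \<in> borel_measurable M" and a: "a > 0"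
    and e: "integrable M (\<lambda>x. exp (a * \<bar>X x\<bar>))" and n: "n > 0"
  shows "integrable M (\<lambda>x. X x ^ n)"
proof (rule Bochner_Integration.integrable_bound)
  show "integrable M (\<lambda>x. (n / a) ^ n * exp (a * \<bar>X x\<bar>))"
    using e by simp
  show "AE x in M. norm (X x ^ n) \<le> norm ((n / a) ^ n * exp (a * \<bar>X x\<bar>))"
    using abs_power_le_exp[OF a n] a by (intro AE_I2) (simp add: power_abs abs_mult)
qed measurable

text \<open>
  The third-order Taylor remainder of \<open>exp (c X)\<close> is at most \<open>c\<^sup>3 \<bar>X\<bar>\<^sup>3 exp (c \<bar>X\<bar>)\<close>.
  Half of the exponential moment \<open>exp (a \<bar>X\<bar>)\<close> pays for the cube and the other half for
  \<open>exp (c \<bar>X\<bar>)\<close>, whence the range \<open>c \<le> a / 2\<close>.  As \<open>E[X] = 0\<close>, this makes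
  \<open>E[exp (c X)] - 1\<close> of order \<open>c\<^sup>2\<close>, so that the logarithm contributes an error of order \<open>c\<^sup>4\<close> only.
\<close>

lemma (in prob_space) cumulant_quadratic:
  fixes X :: "'a \<Rightarrow> real"
  assumes X[measurable]: "X \<in> borel_measurable M" and a: "a > 0"
    and e: "integrable M (\<lambda>x. exp (a * \<bar>X x\<bar>))" and X0: "expectation X = 0"
  shows "\<exists>B\<ge>0. \<forall>c. 0 < c \<and> c \<le> a / 2 \<longrightarrow> integrable M (\<lambda>x. exp (c * X x)) \<and>
    \<bar>ln (expectation (\<lambda>x. exp (c * X x))) - c\<^sup>2 / 2 * expectation (\<lambda>x. (X x)\<^sup>2)\<bar> \<le> B * c ^ 3"
proof -
  have iX: "integrable M X" and iX2: "integrable M (\<lambda>x. (X x)\<^sup>2)"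
    using integrable_power_of_exp_moment[OF X a e, of 1] integrable_power_of_exp_moment[OF X a e, of 2] by auto
  define v where "v = expectation (\<lambda>x. (X x)\<^sup>2)"
  define A where "A = (6 / a) ^ 3 * expectation (\<lambda>x. exp (a * \<bar>X x\<bar>))"
  have v: "v \<ge> 0" by (simp add: v_def)
  have A: "A \<ge> 0" using a by (simp add: A_def)
  define D where "D = v / 2 + A * a"
  have D: "D \<ge> 0" using v A a by (simp add: D_def)
  show ?thesis
  proof (intro exI[of _ "A + D\<^sup>2 * a"] conjI allI impI)
    show "A + D\<^sup>2 * a \<ge> 0" using A a by simp
    fix c assume "0 < c \<and> c \<le> a / 2"
    then have c: "0 < c" "c \<le> a / 2" "c \<le> a" using a by auto
    show i: "integrable M (\<lambda>x. exp (c * X x))"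
    proof (rule Bochner_Integration.integrable_bound[OF e])
      have "norm (exp (c * X x)) \<le> norm (exp (a * \<bar>X x\<bar>))" for x
      proof -
        have "c * X x \<le> c * \<bar>X x\<bar>" using c by (intro mult_left_mono) auto
        also have "\<dots> \<le> a * \<bar>X x\<bar>" using c by (intro mult_right_mono) auto
        finally show ?thesis by simp
      qed
      then show "AE x in M. norm (exp (c * X x)) \<le> norm (exp (a * \<bar>X x\<bar>))" by simp
    qed measurable
    have taylor: "\<bar>exp (c * X x) - 1 - c * X x - c\<^sup>2 / 2 * (X x)\<^sup>2\<bar>
        \<le> c ^ 3 * ((6 / a) ^ 3 * exp (a * \<bar>X x\<bar>))" for x
    proof -
      obtain t where t: "\<bar>t\<bar> \<le> \<bar>c * X x\<bar>"
          "exp (c * X x) = (\<Sum>m<3. (c * X x) ^ m / fact m) + exp t / fact 3 * (c * X x) ^ 3"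
        using Maclaurin_exp_le[of "c * X x" 3] by blast
      have "\<bar>exp (c * X x) - 1 - c * X x - c\<^sup>2 / 2 * (X x)\<^sup>2\<bar> = exp t / 6 * \<bar>c * X x\<bar> ^ 3"
        unfolding t(2) by (simp add: eval_nat_numeral abs_mult fact_reduce)
      also have "\<dots> \<le> exp (a / 2 * \<bar>X x\<bar>) * \<bar>c * X x\<bar> ^ 3"
      proof (intro mult_right_mono)
        have "t \<le> c * \<bar>X x\<bar>" using t(1) c by (simp add: abs_mult)
        also have "\<dots> \<le> a / 2 * \<bar>X x\<bar>" using c by (intro mult_right_mono) auto
        finally have "exp t \<le> exp (a / 2 * \<bar>X x\<bar>)" by simp
        then show "exp t / 6 \<le> exp (a / 2 * \<bar>X x\<bar>)" using exp_ge_zero[of t] by linarith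
      qed simp
      also have "\<dots> = c ^ 3 * (exp (a / 2 * \<bar>X x\<bar>) * \<bar>X x\<bar> ^ 3)"
        using c by (simp add: abs_mult power_mult_distrib)
      also have "\<dots> \<le> c ^ 3 * (exp (a / 2 * \<bar>X x\<bar>) * ((6 / a) ^ 3 * exp (a / 2 * \<bar>X x\<bar>)))"
        using abs_power_le_exp[of "a / 2" 3 "X x"] a c by (intro mult_left_mono) auto
      also have "\<dots> = c ^ 3 * ((6 / a) ^ 3 * exp (a * \<bar>X x\<bar>))"
        by (simp add: exp_add[symmetric] mult.left_commute)
      finally show ?thesis .
    qed
    define m where "m = expectation (\<lambda>x. exp (c * X x)) - 1"
    have "m - c\<^sup>2 / 2 * v = expectation (\<lambda>x. exp (c * X x) - 1 - c * X x - c\<^sup>2 / 2 * (X x)\<^sup>2)"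
      using i iX iX2 X0 by (simp add: m_def v_def prob_space)
    then have "\<bar>m - c\<^sup>2 / 2 * v\<bar> \<le> expectation (\<lambda>x. \<bar>exp (c * X x) - 1 - c * X x - c\<^sup>2 / 2 * (X x)\<^sup>2\<bar>)"
      by (simp only: integral_abs_bound)
    also have "\<dots> \<le> expectation (\<lambda>x. c ^ 3 * ((6 / a) ^ 3 * exp (a * \<bar>X x\<bar>)))"
      using i iX iX2 e by (intro integral_mono[OF _ _ taylor]) simp_all
    also have "\<dots> = A * c ^ 3" by (simp add: A_def)
    finally have m: "\<bar>m - c\<^sup>2 / 2 * v\<bar> \<le> A * c ^ 3" .
    \<comment> \<open>Jensen's inequality, by \<open>1 + t \<le> exp t\<close>.\<close>
    have m0: "m \<ge> 0"
    proof -
      have "expectation (\<lambda>x. 1 + c * X x) \<le> expectation (\<lambda>x. exp (c * X x))"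
        using i iX by (intro integral_mono) auto
      then show ?thesis using iX X0 by (simp add: m_def prob_space)
    qed
    have "m \<le> D * c\<^sup>2"
    proof -
      have "A * c ^ 3 \<le> A * (a * c\<^sup>2)"
        using A c by (simp add: power3_eq_cube power2_eq_square mult_left_mono mult_right_mono)
      then show ?thesis using m by (simp add: D_def algebra_simps)
    qed
    then have "m\<^sup>2 \<le> (D * c\<^sup>2)\<^sup>2" using m0 by (intro power_mono) auto
    also have "\<dots> = D\<^sup>2 * (c * c ^ 3)" by (simp add: power_mult_distrib eval_nat_numeral)
    also have "\<dots> \<le> D\<^sup>2 * (a * c ^ 3)" using c by (intro mult_left_mono mult_right_mono) auto
    finally have m2: "m\<^sup>2 \<le> D\<^sup>2 * a * c ^ 3" by simp
    have "ln (1 + m) \<le> m" "m - m\<^sup>2 \<le> ln (1 + m)"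
      using m0 ln_add_one_self_le_self[of m] ln_one_plus_lower[of m] by auto
    moreover have "0 \<le> D\<^sup>2 * a * c ^ 3" using a c by simp
    moreover have "(A + D\<^sup>2 * a) * c ^ 3 = A * c ^ 3 + D\<^sup>2 * a * c ^ 3" by (rule distrib_right)
    moreover have E: "expectation (\<lambda>x. exp (c * X x)) = 1 + m" by (simp add: m_def)
    ultimately show "\<bar>ln (expectation (\<lambda>x. exp (c * X x))) - c\<^sup>2 / 2 * expectation (\<lambda>x. (X x)\<^sup>2)\<bar>
        \<le> (A + D\<^sup>2 * a) * c ^ 3"
      using m m2 unfolding v_def[symmetric] E by linarith
  qed
qed

text \<open>
  Lyapunov's inequality \<open>E[exp (c X)] \<le> E[exp (d X)]\<^sup>q\<close> with \<open>q = c / d\<close>.  Convexity of \<open>exp\<close>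
  between \<open>0\<close> and \<open>y\<close> gives \<open>exp (q y) \<le> q exp y + (1 - q)\<close>; at \<open>y = d X - ln Z\<close>, with
  \<open>Z = E[exp (d X)]\<close>, the right-hand side has expectation \<open>1\<close>.
\<close>

lemma (in prob_space) cumulant_rate_mono:
  fixes X :: "'a \<Rightarrow> real"
  assumes c: "0 < c" "c \<le> d" and e: "integrable M (\<lambda>x. exp (d * X x))"
    and X[measurable]: "X \<in> borel_measurable M"
  shows "integrable M (\<lambda>x. exp (c * X x))"
    and "1 / c * ln (expectation (\<lambda>x. exp (c * X x))) \<le> 1 / d * ln (expectation (\<lambda>x. exp (d * X x)))"
proof -
  define q where "q = c / d"
  have q: "0 < q" "q \<le> 1" using c by (auto simp: q_def)
  have young: "exp (q * y) \<le> q * exp y + (1 - q)" for y :: real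
    using convex_onD[OF exp_convex, of q 0 y] q by simp
  have cq: "c = q * d" using c by (simp add: q_def)
  show i: "integrable M (\<lambda>x. exp (c * X x))"
  proof (rule Bochner_Integration.integrable_bound)
    show "integrable M (\<lambda>x. q * exp (d * X x) + (1 - q))" using e by simp
    show "AE x in M. norm (exp (c * X x)) \<le> norm (q * exp (d * X x) + (1 - q))"
      using young[of "d * X _"] q by (intro AE_I2) (simp add: cq mult.assoc)
  qed measurable
  define Z where "Z = expectation (\<lambda>x. exp (d * X x))"
  have Z: "Z > 0" unfolding Z_def using e by (intro expectation_greater) auto
  have Zc: "expectation (\<lambda>x. exp (c * X x)) > 0" using i by (intro expectation_greater) auto
  have "expectation (\<lambda>x. exp (c * X x) / exp (q * ln Z)) \<le> expectation (\<lambda>x. q * (exp (d * X x) / Z) + (1 - q))"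
  proof (intro integral_mono)
    show "exp (c * X x) / exp (q * ln Z) \<le> q * (exp (d * X x) / Z) + (1 - q)" for x
      using young[of "d * X x - ln Z"] Z
      by (simp add: cq exp_diff right_diff_distrib mult.assoc)
  qed (use i e in auto)
  also have "\<dots> = 1" using e Z by (simp add: prob_space Z_def[symmetric])
  finally have "expectation (\<lambda>x. exp (c * X x)) \<le> exp (q * ln Z)" by (simp add: field_simps)
  then have "ln (expectation (\<lambda>x. exp (c * X x))) \<le> q * ln Z"
    using Zc by (metis ln_exp ln_mono exp_gt_zero)
  then show "1 / c * ln (expectation (\<lambda>x. exp (c * X x))) \<le> 1 / d * ln (expectation (\<lambda>x. exp (d * X x)))"
    using c unfolding Z_def[symmetric] by (simp add: q_def field_simps)
qed


section \<open>Linearization of the hybrid divergence\<close>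

text \<open>
  The constants \<open>\<delta>\<close> and \<open>C\<close> come before \<open>\<mu>\<close>: the hybrid divergence depends on \<open>\<mu>\<close> only through
  the number \<open>R\<close>, which is what makes the expansion uniform.  Zero variance is a separate case,
  since the minimizer \<open>\<surd>(2 R) / s\<close> is not available there.
\<close>

lemma (in prob_space) hybrid_divergence_linearization:
  fixes F :: "'a \<Rightarrow> real"
  assumes F[measurable]: "F \<in> borel_measurable M" and a: "a > 0"
    and e: "integrable M (\<lambda>x. exp (a * \<bar>F x\<bar>))"
  shows "\<exists>\<delta>>0. \<exists>C. \<forall>\<mu> R. relative_entropy \<mu> M = ereal R \<and> 0 \<le> R \<and> R < \<delta> \<longrightarrow>
    (\<exists>k. hybrid_divergence \<mu> M F = ereal k \<and> \<bar>k - sqrt (variance F) * sqrt (2 * R)\<bar> \<le> C * R)"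
proof -
  define X where "X x = F x - expectation F" for x
  have [measurable]: "X \<in> borel_measurable M" unfolding X_def by measurable
  have iF: "integrable M F"
    using integrable_power_of_exp_moment[OF F a e, of 1] by simp
  have X0: "expectation X = 0"
    using iF by (simp add: X_def[abs_def] prob_space)
  have eX: "integrable M (\<lambda>x. exp (a * \<bar>X x\<bar>))"
  proof (rule Bochner_Integration.integrable_bound)
    show "integrable M (\<lambda>x. exp (a * \<bar>expectation F\<bar>) * exp (a * \<bar>F x\<bar>))"
      using e by simp
    have "a * \<bar>X x\<bar> \<le> a * (\<bar>expectation F\<bar> + \<bar>F x\<bar>)" for x
      using a by (intro mult_left_mono) (auto simp: X_def)
    then show "AE x in M. norm (exp (a * \<bar>X x\<bar>)) \<le> norm (exp (a * \<bar>expectation F\<bar>) * exp (a * \<bar>F x\<bar>))"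
      by (intro AE_I2) (simp add: exp_add[symmetric] distrib_left)
  qed measurable
  have iX2: "integrable M (\<lambda>x. (X x)\<^sup>2)"
    using integrable_power_of_exp_moment[OF _ a eX, of 2] by simp
  have var: "variance F = expectation (\<lambda>x. (X x)\<^sup>2)" by (simp add: X_def)
  have hyb: "hybrid_divergence \<mu> M F = (INF c\<in>{0<..}. risk_sensitive M c F + ereal (R / c))"
    if "relative_entropy \<mu> M = ereal R" for \<mu> R
    unfolding hybrid_divergence_def that by simp
  show ?thesis
  proof (cases "variance F = 0")
    case True
    have "expectation (\<lambda>x. (X x)\<^sup>2) = 0"
      using True unfolding var .
    then have ae0: "AE x in M. (X x)\<^sup>2 = 0"
      using integral_nonneg_eq_0_iff_AE[OF iX2] by simp
    have ae: "AE x in M. exp (c * X x) = 1" for c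
      using ae0 by eventually_elim simp
    have rs: "risk_sensitive M c F = 0" for c
    proof -
      have "integrable M (\<lambda>x. exp (c * X x)) \<longleftrightarrow> integrable M (\<lambda>x. 1::real)"
        by (intro integrable_cong_AE ae) auto
      moreover have "expectation (\<lambda>x. exp (c * X x)) = expectation (\<lambda>x. 1)"
        by (intro integral_cong_AE ae) auto
      ultimately show ?thesis
        by (simp add: risk_sensitive_def X_def[symmetric] prob_space)
    qed
    have "(INF c\<in>{0<..}. ereal (R / c)) = 0" if "R \<ge> 0" for R
    proof (rule antisym)
      show "0 \<le> (INF c\<in>{0<..}. ereal (R / c))"
        using that by (intro INF_greatest) auto
      have "(INF c\<in>{0<..}. ereal (R / c)) \<le> 0 + ereal d" if d: "d > 0" for d
      proof -
        \<comment> \<open>\<open>R + 1\<close> in place of \<open>R\<close> keeps \<open>c\<close> positive when \<open>R = 0\<close>.\<close>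
        have "(INF c\<in>{0<..}. ereal (R / c)) \<le> ereal (R / ((R + 1) / d))"
          using \<open>R \<ge> 0\<close> d by (intro INF_lower) auto
        also have "R / ((R + 1) / d) \<le> d"
          using \<open>R \<ge> 0\<close> d by (simp add: field_simps)
        finally show ?thesis by simp
      qed
      then show "(INF c\<in>{0<..}. ereal (R / c)) \<le> 0"
        by (rule ereal_le_epsilon2)
    qed
    then show ?thesis
      using True by (intro exI[of _ 1] conjI exI[of _ 0]) (auto simp: hyb rs)
  next
    case False
    define s where "s = sqrt (variance F)"
    have "expectation (\<lambda>x. (X x)\<^sup>2) > 0"
      using False variance_positive[of F] unfolding var by linarith
    then have s: "s > 0" "s\<^sup>2 = expectation (\<lambda>x. (X x)\<^sup>2)"
      by (simp_all add: s_def var)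
    obtain B where B: "B \<ge> 0" and quad: "\<And>c. 0 < c \<Longrightarrow> c \<le> a / 2 \<Longrightarrow> integrable M (\<lambda>x. exp (c * X x)) \<and>
        \<bar>ln (expectation (\<lambda>x. exp (c * X x))) - c\<^sup>2 / 2 * s\<^sup>2\<bar> \<le> B * c ^ 3"
      using cumulant_quadratic[OF _ a eX X0] unfolding s(2) by auto
    have "\<exists>\<delta>>0. \<exists>C. \<forall>R. 0 \<le> R \<and> R < \<delta> \<longrightarrow>
        (\<exists>k. (INF c\<in>{0<..}. risk_sensitive M c F + ereal (R / c)) = ereal k \<and> \<bar>k - s * sqrt (2 * R)\<bar> \<le> C * R)"
    proof (rule INF_perturbed_linear[OF s(1) B])
      show "a / 2 > 0" using a by simp
      fix c :: real assume c: "0 < c" "c \<le> a / 2"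
      define K where "K = ln (expectation (\<lambda>x. exp (c * X x)))"
      have K: "\<bar>K - c\<^sup>2 / 2 * s\<^sup>2\<bar> \<le> B * c ^ 3" using quad[OF c] by (simp add: K_def)
      have "\<bar>1 / c * K - s\<^sup>2 * c / 2\<bar> = \<bar>K - c\<^sup>2 / 2 * s\<^sup>2\<bar> / c"
      proof -
        have "1 / c * K - s\<^sup>2 * c / 2 = (K - c\<^sup>2 / 2 * s\<^sup>2) / c"
          using c by (simp add: field_simps power2_eq_square)
        then show ?thesis using c by (simp add: abs_divide del: times_divide_eq_left)
      qed
      also have "\<dots> \<le> B * c ^ 3 / c" using K c by (intro divide_right_mono) auto
      also have "\<dots> = B * c\<^sup>2" using c by (simp add: power3_eq_cube power2_eq_square)
      finally show "\<exists>k. risk_sensitive M c F = ereal k \<and> \<bar>k - s\<^sup>2 * c / 2\<bar> \<le> B * c\<^sup>2"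
        using quad[OF c] by (simp add: risk_sensitive_def X_def[symmetric] K_def)
    next
      fix c d :: real assume "0 < c" "c \<le> d"
      then show "risk_sensitive M c F \<le> risk_sensitive M d F"
        using cumulant_rate_mono[of c d X] by (auto simp: risk_sensitive_def X_def[symmetric])
    qed
    then obtain \<delta> C where "\<delta> > 0" and lin: "\<And>R. 0 \<le> R \<Longrightarrow> R < \<delta> \<Longrightarrow>
        \<exists>k. (INF c\<in>{0<..}. risk_sensitive M c F + ereal (R / c)) = ereal k \<and> \<bar>k - s * sqrt (2 * R)\<bar> \<le> C * R"
      by blast
    show ?thesis
    proof (rule exI[of _ \<delta>], rule conjI[OF \<open>\<delta> > 0\<close>], rule exI[of _ C], intro allI impI)
      fix \<mu> R assume *: "relative_entropy \<mu> M = ereal R \<and> 0 \<le> R \<and> R < \<delta>"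
      then show "\<exists>k. hybrid_divergence \<mu> M F = ereal k \<and> \<bar>k - sqrt (variance F) * sqrt (2 * R)\<bar> \<le> C * R"
        using lin[of R] hyb[of \<mu> R] unfolding s_def by simp
    qed
  qed
qed

lemma hybrid_divergence_asymptotics:
  fixes \<gamma> :: "'y::polish_space measure" and F :: "'y \<Rightarrow> real"
  assumes \<gamma>: "\<gamma> \<in> space (prob_algebra borel)"
    and F: "F \<in> borel_measurable borel" and a: "a > 0"
    and e: "integrable \<gamma> (\<lambda>x. exp (a * \<bar>F x\<bar>))"
  shows "eventually (\<lambda>\<mu>. \<bar>hybrid_divergence \<mu> \<gamma> F\<bar> \<noteq> \<infinity>) (entropy_to_0 \<gamma>)"
    and "(\<lambda>\<mu>. real_of_ereal (hybrid_divergence \<mu> \<gamma> F)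
            - sqrt (prob_space.variance \<gamma> F) * sqrt (2 * real_of_ereal (relative_entropy \<mu> \<gamma>)))
          \<in> O[entropy_to_0 \<gamma>](\<lambda>\<mu>. real_of_ereal (relative_entropy \<mu> \<gamma>))"
proof -
  have p: "prob_space \<gamma>" and sets: "sets \<gamma> = sets borel"
    using \<gamma> by (auto simp: space_prob_algebra_borel_iff)
  interpret prob_space \<gamma> by fact
  have "F \<in> borel_measurable \<gamma>" using F measurable_cong_sets[OF sets refl] by blast
  from hybrid_divergence_linearization[OF this a e]
  obtain \<delta> C where \<delta>: "\<delta> > 0" and lin: "\<And>\<mu> R. relative_entropy \<mu> \<gamma> = ereal R \<Longrightarrow> 0 \<le> R \<Longrightarrow> R < \<delta> \<Longrightarrow>
      \<exists>k. hybrid_divergence \<mu> \<gamma> F = ereal k \<and> \<bar>k - sqrt (variance F) * sqrt (2 * R)\<bar> \<le> C * R"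
    by blast
  have ev: "eventually (\<lambda>\<mu>. \<exists>R k. 0 \<le> R \<and> relative_entropy \<mu> \<gamma> = ereal R \<and>
      hybrid_divergence \<mu> \<gamma> F = ereal k \<and> \<bar>k - sqrt (variance F) * sqrt (2 * R)\<bar> \<le> C * R) (entropy_to_0 \<gamma>)"
    unfolding eventually_entropy_to_0
  proof (rule exI[of _ \<delta>], intro conjI ballI impI \<delta>)
    fix \<mu> :: "'y measure" assume \<mu>: "\<mu> \<in> space (prob_algebra borel)" "\<bar>relative_entropy \<mu> \<gamma>\<bar> < ereal \<delta>"
    obtain R where R: "relative_entropy \<mu> \<gamma> = ereal R" using \<mu>(2) by (cases "relative_entropy \<mu> \<gamma>") auto
    have "R \<ge> 0"
      using relative_entropy_nonneg[OF p, of \<mu>] \<mu>(1) R sets by (simp add: space_prob_algebra_borel_iff)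
    then show "\<exists>R k. 0 \<le> R \<and> relative_entropy \<mu> \<gamma> = ereal R \<and>
      hybrid_divergence \<mu> \<gamma> F = ereal k \<and> \<bar>k - sqrt (variance F) * sqrt (2 * R)\<bar> \<le> C * R"
      using lin[OF R] R \<mu>(2) by auto
  qed
  show "eventually (\<lambda>\<mu>. \<bar>hybrid_divergence \<mu> \<gamma> F\<bar> \<noteq> \<infinity>) (entropy_to_0 \<gamma>)"
    using ev by eventually_elim auto
  show "(\<lambda>\<mu>. real_of_ereal (hybrid_divergence \<mu> \<gamma> F)
            - sqrt (variance F) * sqrt (2 * real_of_ereal (relative_entropy \<mu> \<gamma>)))
          \<in> O[entropy_to_0 \<gamma>](\<lambda>\<mu>. real_of_ereal (relative_entropy \<mu> \<gamma>))"
    by (rule bigoI[of _ C], use ev in eventually_elim) auto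
qed

section \<open>The divergence bounds and their linearization\<close>

theorem theorem1:
  fixes \<gamma> :: "'y::polish_space measure"
    and \<nu> :: "'y \<Rightarrow> 'z::polish_space measure"
    and h :: "'y \<times> 'z \<Rightarrow> real"
  assumes "\<gamma> \<in> space (prob_algebra borel)"
    and "\<nu> \<in> borel \<rightarrow>\<^sub>M prob_algebra borel"
    and "h \<in> borel_measurable (borel \<Otimes>\<^sub>M borel)"
    and "\<And>y. integrable (\<nu> y) (\<lambda>z. h (y, z))"
    and "marginal_performance \<nu> h \<in> borel_measurable borel"
    and "\<exists>c0>0. \<forall>c. \<bar>c\<bar> < c0 \<longrightarrow>
          (\<integral>\<^sup>+y. ennreal (exp (c * marginal_performance \<nu> h y)) \<partial>\<gamma>) < \<infinity>"
  shows "(\<forall>\<mu>\<in>space (prob_algebra borel). relative_entropy \<mu> \<gamma> < \<infinity> \<longrightarrow>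
            integrable \<mu> (marginal_performance \<nu> h) \<and>
            - hybrid_divergence \<mu> \<gamma> (\<lambda>y. - marginal_performance \<nu> h y)
              \<le> ereal (joint_expectation \<mu> \<nu> h - joint_expectation \<gamma> \<nu> h) \<and>
            ereal (joint_expectation \<mu> \<nu> h - joint_expectation \<gamma> \<nu> h)
              \<le> hybrid_divergence \<mu> \<gamma> (marginal_performance \<nu> h)) \<and>
         (\<forall>F\<in>{marginal_performance \<nu> h, \<lambda>y. - marginal_performance \<nu> h y}.
            eventually (\<lambda>\<mu>. \<bar>hybrid_divergence \<mu> \<gamma> F\<bar> \<noteq> \<infinity>) (entropy_to_0 \<gamma>) \<and>
            (\<lambda>\<mu>. real_of_ereal (hybrid_divergence \<mu> \<gamma> F)
                 - sqrt (prob_space.variance \<gamma> (marginal_performance \<nu> h))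
                   * sqrt (2 * real_of_ereal (relative_entropy \<mu> \<gamma>)))
              \<in> O[entropy_to_0 \<gamma>](\<lambda>\<mu>. real_of_ereal (relative_entropy \<mu> \<gamma>)))"
proof -
  define H where "H = marginal_performance \<nu> h"
  obtain c0 where c0: "c0 > 0" and moments: "\<And>c. \<bar>c\<bar> < c0 \<Longrightarrow> (\<integral>\<^sup>+y. ennreal (exp (c * H y)) \<partial>\<gamma>) < \<infinity>"
    using assms(6) by (auto simp: H_def)
  have p: "prob_space \<gamma>" and sets: "sets \<gamma> = sets borel"
    using assms(1) by (auto simp: space_prob_algebra_borel_iff)
  interpret prob_space \<gamma> by fact
  have Hb: "H \<in> borel_measurable borel" using assms(5) by (simp add: H_def)
  have H[measurable]: "H \<in> borel_measurable \<gamma>"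
    using Hb measurable_cong_sets[OF sets refl] by blast
  \<comment> \<open>The hypothesis covers only exponents strictly between \<open>- c0\<close> and \<open>c0\<close>.\<close>
  define a where "a = c0 / 2"
  have a: "a > 0" using c0 by (simp add: a_def)
  have int_exp: "integrable \<gamma> (\<lambda>y. exp (c * H y))" if "\<bar>c\<bar> < c0" for c
    using moments[OF that] by (intro integrableI_nonneg) auto
  have abs_exp: "exp (a * \<bar>t\<bar>) \<le> exp (a * t) + exp (- a * t)" for t
    by (cases "t \<ge> 0") auto
  have e: "integrable \<gamma> (\<lambda>y. exp (a * \<bar>H y\<bar>))"
  proof (rule Bochner_Integration.integrable_bound)
    show "integrable \<gamma> (\<lambda>y. exp (a * H y) + exp (- a * H y))"
      using c0 by (intro Bochner_Integration.integrable_add int_exp) (auto simp: a_def)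
    show "AE y in \<gamma>. norm (exp (a * \<bar>H y\<bar>)) \<le> norm (exp (a * H y) + exp (- a * H y))"
      using abs_exp by (intro AE_I2) (simp add: abs_of_nonneg)
  qed measurable
  have je: "joint_expectation \<mu> \<nu> h = (\<integral>y. H y \<partial>\<mu>)" for \<mu>
    by (simp add: joint_expectation_def H_def marginal_performance_def)
  have bounds: "integrable \<mu> H \<and>
      - hybrid_divergence \<mu> \<gamma> (\<lambda>y. - H y) \<le> ereal ((\<integral>y. H y \<partial>\<mu>) - (\<integral>y. H y \<partial>\<gamma>)) \<and>
      ereal ((\<integral>y. H y \<partial>\<mu>) - (\<integral>y. H y \<partial>\<gamma>)) \<le> hybrid_divergence \<mu> \<gamma> H"
    if \<mu>: "\<mu> \<in> space (prob_algebra borel)" and R: "relative_entropy \<mu> \<gamma> < \<infinity>" for \<mu>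
  proof -
    have p': "prob_space \<mu>" "sets \<mu> = sets \<gamma>"
      using \<mu> sets by (auto simp: space_prob_algebra_borel_iff)
    have iH: "integrable \<mu> H"
      by (rule integrable_of_finite_relative_entropy[OF p p' R H a e])
    have "ereal ((\<integral>y. - H y \<partial>\<mu>) - (\<integral>y. - H y \<partial>\<gamma>)) \<le> hybrid_divergence \<mu> \<gamma> (\<lambda>y. - H y)"
      using iH by (intro expectation_diff_le_hybrid_divergence p p' R) simp
    then have "- hybrid_divergence \<mu> \<gamma> (\<lambda>y. - H y) \<le> - ereal ((\<integral>y. - H y \<partial>\<mu>) - (\<integral>y. - H y \<partial>\<gamma>))"
      by (simp only: ereal_minus_le_minus)
    then show ?thesis
      using iH expectation_diff_le_hybrid_divergence[OF p p' R iH] by simp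
  qed
  have var: "variance (\<lambda>y. - H y) = variance H"
    by (simp add: power2_eq_square algebra_simps)
  have "eventually (\<lambda>\<mu>. \<bar>hybrid_divergence \<mu> \<gamma> F\<bar> \<noteq> \<infinity>) (entropy_to_0 \<gamma>) \<and>
      (\<lambda>\<mu>. real_of_ereal (hybrid_divergence \<mu> \<gamma> F)
         - sqrt (variance H) * sqrt (2 * real_of_ereal (relative_entropy \<mu> \<gamma>)))
      \<in> O[entropy_to_0 \<gamma>](\<lambda>\<mu>. real_of_ereal (relative_entropy \<mu> \<gamma>))"
    if "F = H \<or> F = (\<lambda>y. - H y)" for F
  proof -
    have 1: "F \<in> borel_measurable borel" "integrable \<gamma> (\<lambda>y. exp (a * \<bar>F y\<bar>))" "variance F = variance H"
      using that e Hb var by auto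
    show ?thesis
      using hybrid_divergence_asymptotics[OF assms(1) 1(1) a 1(2)] unfolding 1(3) by blast
  qed
  then show ?thesis
    unfolding je H_def[symmetric] using bounds by (intro conjI ballI impI) auto
qed

end
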